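(* For every $k\ge2$ and all $x_1,\dots,x_k\in\mathcal O_K$, $$\theta^{-k}|x_1|_\theta\cdots|x_k|_\theta\le |x_1\cdots x_k|_\theta\le \theta^{k}|x_1|_\theta\cdots|x_k|_\theta .$$
   Context: $\theta>1$ is a real quadratic unit with $N(\theta)=-1$, so $\theta^2=a\theta+1$ with an integer $a\ge1$; $K=\mathbb Q(\theta)\subset\mathbb R$, $\mathcal O_K$ its ring of integers. A greedy polynomial is a finite sum $\sum_{i=m}^M b_i\theta^i$ with $b_i\in\{0,\dots,a\}$ such that $b_i=a$ implies $b_{i-1}=0$. Every nonzero $\alpha\in\mathcal O_K$ can be written uniquely as $\alpha=\pm\sum_{i=m}^M b_i\theta^i$ with the sum a greedy polynomial and $b_m\ne0$. The $\theta$-adic infranorm is $|\alpha|_\theta:=\theta^{-m}$, and $|0|_\theta:=0$.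
   Formalization: The x_i are also required to lie in Z[θ], the elements on which |·|_θ is defined; for θ=2+√5 the element (1+√5)/2 of O_K has no greedy expansion, so its infranorm is undefined. If O_K=Z[θ], nothing changes. *)

theory Defs
  imports Complex_Main "HOL-Computational_Algebra.Polynomial"
begin

(* The field Q(theta) as a subset of the reals: all quotients of polynomial expressions
   in theta with rational coefficients (a vanishing denominator only contributes 0). *)
definition rat_adjoin :: "real \<Rightarrow> real set" where
  "rat_adjoin \<theta> =
     {poly (map_poly of_rat p) \<theta> / poly (map_poly of_rat q) \<theta> | p q :: rat poly. True}"

definition ring_of_ints :: "real \<Rightarrow> real set" where
  "ring_of_ints \<theta> = {\<alpha> \<in> rat_adjoin \<theta>. algebraic_int \<alpha>}"

(* The order Z[theta]. *)
definition int_adjoin :: "real \<Rightarrow> real set" where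
  "int_adjoin \<theta> = {poly (map_poly of_int p) \<theta> | p :: int poly. True}"

(* Finite digit strings are finitely supported functions on all of int, so the digit just
   below the lowest nonzero one is 0 and imposes no condition at the lower end. *)
definition greedy_digits :: "nat \<Rightarrow> (int \<Rightarrow> nat) \<Rightarrow> bool" where
  "greedy_digits a b \<longleftrightarrow>
     finite {i. b i \<noteq> 0} \<and> (\<forall>i. b i \<le> a) \<and> (\<forall>i. b i = a \<longrightarrow> b (i - 1) = 0)"

definition greedy_value :: "real \<Rightarrow> (int \<Rightarrow> nat) \<Rightarrow> real" where
  "greedy_value \<theta> b = (\<Sum>i | b i \<noteq> 0. of_nat (b i) * \<theta> powi i)"

definition greedy_expansion :: "nat \<Rightarrow> real \<Rightarrow> real \<Rightarrow> int \<Rightarrow> (int \<Rightarrow> nat) \<Rightarrow> bool" where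
  "greedy_expansion a \<theta> \<alpha> m b \<longleftrightarrow>
     greedy_digits a b \<and> b m \<noteq> 0 \<and> (\<forall>i<m. b i = 0) \<and>
     (\<alpha> = greedy_value \<theta> b \<or> \<alpha> = - greedy_value \<theta> b)"

(* Only meaningful for alpha = 0 or alpha with a greedy expansion.  Since theta is a unit,
   every greedy polynomial lies in Z[theta], so alpha must lie there too. *)
definition infranorm :: "nat \<Rightarrow> real \<Rightarrow> real \<Rightarrow> real" where
  "infranorm a \<theta> \<alpha> =
     (if \<alpha> = 0 then 0 else \<theta> powi (- (THE m. \<exists>b. greedy_expansion a \<theta> \<alpha> m b)))"

end

theory Submission
  imports Defs
begin

text \<open>
  Let \<open>\<eta> = - 1 / \<theta>\<close> be the conjugate of \<open>\<theta>\<close>. If the greedy expansion of \<open>\<alpha>\<close> starts at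
  \<open>\<theta>\<^sup>m\<close>, the conjugate of \<open>\<alpha>\<close> is \<open>\<plusminus> \<eta>\<^sup>m u\<close>, where \<open>u\<close> is an alternating sum in powers of
  \<open>1 / \<theta>\<close>, and the digit conditions force \<open>1 / \<theta> < u < \<theta>\<close>. So the multiplicative function
  \<open>\<bar>\<alpha>'\<bar>\<close> differs from the infranorm by a factor strictly between \<open>1 / \<theta>\<close> and \<open>\<theta>\<close>. For a
  product of \<open>k\<close> factors this costs \<open>k + 1\<close> such factors; as all infranorms are integral
  powers of \<open>\<theta>\<close>, strictness improves the exponent to \<open>k\<close>.
\<close>

section \<open>Values and shifts of digit strings\<close>

text \<open>Allows the support of \<open>b\<close> to be replaced by any convenient finite index
  set, for instance an interval padded with zero digits.\<close>

lemma greedy_value_eq_sum: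
  assumes "finite S" and "\<And>i. b i \<noteq> 0 \<Longrightarrow> i \<in> S"
  shows "greedy_value t b = (\<Sum>i\<in>S. of_nat (b i) * t powi i)"
  unfolding greedy_value_def
  by (rule sum.mono_neutral_left) (use assms in auto)

lemma support_shift: "{i. b (i - n) \<noteq> 0} = (\<lambda>i. i + n) ` {i. b i \<noteq> 0}"
  for b :: "int \<Rightarrow> nat" and n :: int
proof (intro equalityI subsetI)
  fix i
  assume "i \<in> {i. b (i - n) \<noteq> 0}"
  then show "i \<in> (\<lambda>i. i + n) ` {i. b i \<noteq> 0}"
    by (intro image_eqI[of _ _ "i - n"]) auto
qed auto

lemma greedy_value_shift:
  assumes "t \<noteq> 0"
  shows "greedy_value t (\<lambda>i. b (i - n)) = t powi n * greedy_value t b"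
  unfolding greedy_value_def support_shift using assms
  by (subst sum.reindex) (auto simp: sum_distrib_left power_int_add mult_ac inj_on_def)

lemma greedy_digits_shift:
  assumes "greedy_digits a b"
  shows "greedy_digits a (\<lambda>i. b (i - n))"
proof -
  have "i - n - 1 = i - 1 - n" for i :: int
    by simp
  then show ?thesis
    using assms unfolding greedy_digits_def support_shift by (metis finite_imageI)
qed

lemma digit_le_greedy_value:
  assumes "greedy_digits a b" and "t > 0"
  shows "of_nat (b i) * t powi i \<le> greedy_value t b"
proof (cases "b i = 0")
  case True
  then show ?thesis
    using assms(2) unfolding greedy_value_def by (auto intro!: sum_nonneg)
next
  case False
  then show ?thesis
    using assms unfolding greedy_value_def greedy_digits_def
    by (intro member_le_sum) auto
qed

lemma greedy_value_pos:
  assumes "greedy_digits a b" and "t > 0" and "b m \<noteq> 0"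
  shows "greedy_value t b > 0"
proof -
  have "0 < of_nat (b m) * t powi m"
    using assms by simp
  then show ?thesis
    using digit_le_greedy_value[OF assms(1,2), of m] by linarith
qed

lemma greedy_value_fun_upd:
  assumes "greedy_digits a b" and "b i = 0"
  shows "greedy_value t (b(i := d)) = of_nat d * t powi i + greedy_value t b"
proof -
  define S where "S = {i. b i \<noteq> 0}"
  have fin: "finite S" and "i \<notin> S"
    using assms by (auto simp: S_def greedy_digits_def)
  have "greedy_value t (b(i := d)) = (\<Sum>j\<in>insert i S. of_nat ((b(i := d)) j) * t powi j)"
    by (rule greedy_value_eq_sum) (use fin in \<open>auto simp: S_def split: if_splits\<close>)
  also have "\<dots> = of_nat d * t powi i + (\<Sum>j\<in>S. of_nat ((b(i := d)) j) * t powi j)"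
    using fin \<open>i \<notin> S\<close> by simp
  also have "(\<Sum>j\<in>S. of_nat ((b(i := d)) j) * t powi j) = greedy_value t b"
    unfolding greedy_value_def S_def[symmetric]
    by (rule sum.cong) (use \<open>i \<notin> S\<close> in auto)
  finally show ?thesis .
qed

section \<open>The unit and its conjugate\<close>

locale quadratic_unit =
  fixes \<theta> \<eta> :: real and a :: nat
  assumes theta_gt_1: "\<theta> > 1" and a_ge_1: "a \<ge> 1"
    and theta_square: "\<theta>\<^sup>2 = of_nat a * \<theta> + 1"
    and eta_def: "\<eta> = - 1 / \<theta>"
begin

lemma theta_pos: "\<theta> > 0"
  using theta_gt_1 by simp

lemma inverse_theta: "1 / \<theta> = \<theta> - a"
  using theta_square theta_pos by (simp add: field_simps power2_eq_square)

lemma eta_eq: "\<eta> = a - \<theta>"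
  using inverse_theta eta_def by simp

lemma eta_square: "\<eta>\<^sup>2 = of_nat a * \<eta> + 1"
  using theta_square unfolding eta_eq by (simp add: power2_eq_square algebra_simps)

lemma eta_nonzero: "\<eta> \<noteq> 0"
  using theta_pos eta_def by simp

lemma theta_bounds: "real a < \<theta>" "\<theta> < real a + 1"
proof -
  have "0 < 1 / \<theta>" "1 / \<theta> < 1"
    using theta_gt_1 by auto
  then show "real a < \<theta>" "\<theta> < real a + 1"
    unfolding inverse_theta by auto
qed

text \<open>A rational algebraic integer is an integer, but \<theta> lies strictly between
  \<open>a\<close> and \<open>a + 1\<close>.\<close>

lemma theta_irrational: "\<theta> \<notin> \<rat>"
proof
  assume "\<theta> \<in> \<rat>"
  moreover have "algebraic_int \<theta>"
  proof (rule algebraic_int.intros)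
    show "poly [:-1, - of_nat a, 1:] \<theta> = 0"
      using theta_square by (simp add: power2_eq_square algebra_simps)
    show "\<forall>i. coeff [:-1, - of_nat a, 1 :: real:] i \<in> \<int>"
      by (auto simp: coeff_pCons split: nat.split)
  qed simp
  ultimately have "\<theta> \<in> \<int>"
    by (rule rational_algebraic_int_is_int[rotated])
  then obtain n :: int where n: "\<theta> = of_int n"
    by (elim Ints_cases)
  with theta_bounds have "int a < n" "n < int a + 1"
    by linarith+
  then show False
    by simp
qed

section \<open>Conjugation as a ring homomorphism\<close>

text \<open>This is the graph of the nontrivial field automorphism on the order generated by
  \<theta>. As a relation it needs no choice of coordinates, and compatibility with the ring
  operations can be shown before single-valuedness is invoked.\<close>

definition conjugates :: "real \<Rightarrow> real \<Rightarrow> bool" where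
  "conjugates \<alpha> \<beta> \<longleftrightarrow>
     (\<exists>p q :: int. \<alpha> = of_int p + of_int q * \<theta> \<and> \<beta> = of_int p + of_int q * \<eta>)"

lemma conjugatesI: "conjugates (of_int p + of_int q * \<theta>) (of_int p + of_int q * \<eta>)"
  unfolding conjugates_def by blast

text \<open>Two different representations of \<alpha> in the basis 1, \<theta> would exhibit
  \<theta> as a quotient of integers.\<close>

lemma conjugates_unique:
  assumes "conjugates \<alpha> \<beta>" and "conjugates \<alpha> \<gamma>"
  shows "\<beta> = \<gamma>"
proof -
  obtain p q :: int where 1: "\<alpha> = of_int p + of_int q * \<theta>" "\<beta> = of_int p + of_int q * \<eta>"
    using assms(1) unfolding conjugates_def by blast
  obtain r s :: int where 2: "\<alpha> = of_int r + of_int s * \<theta>" "\<gamma> = of_int r + of_int s * \<eta>"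
    using assms(2) unfolding conjugates_def by blast
  have "q = s"
  proof (rule ccontr)
    assume "q \<noteq> s"
    have "of_int (q - s) * \<theta> = of_int (r - p)"
      using 1 2 by (simp add: algebra_simps)
    then have "\<theta> = of_int (r - p) / of_int (q - s)"
      using \<open>q \<noteq> s\<close> by (simp add: field_simps)
    also have "\<dots> \<in> \<rat>"
      by (intro Rats_divide Rats_of_int)
    finally show False
      using theta_irrational by simp
  qed
  then show ?thesis
    using 1 2 by simp
qed

lemma conjugates_of_int: "conjugates (of_int n) (of_int n)"
  using conjugatesI[of n 0] by simp

lemma conjugates_add:
  assumes "conjugates \<alpha> \<alpha>'" and "conjugates \<beta> \<beta>'"
  shows "conjugates (\<alpha> + \<beta>) (\<alpha>' + \<beta>')"
proof -
  obtain p q r s :: int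
    where "\<alpha> = of_int p + of_int q * \<theta>" "\<alpha>' = of_int p + of_int q * \<eta>"
      and "\<beta> = of_int r + of_int s * \<theta>" "\<beta>' = of_int r + of_int s * \<eta>"
    using assms unfolding conjugates_def by blast
  then show ?thesis
    using conjugatesI[of "p + r" "q + s"] by (simp add: algebra_simps)
qed

text \<open>Both \<theta> and \<eta> are roots of the same quadratic, so one computation with a
  generic root \<open>t\<close> reduces both products to the same integer coefficients.\<close>

lemma conjugates_mult:
  assumes "conjugates \<alpha> \<alpha>'" and "conjugates \<beta> \<beta>'"
  shows "conjugates (\<alpha> * \<beta>) (\<alpha>' * \<beta>')"
proof -
  obtain p q r s :: int
    where pq: "\<alpha> = of_int p + of_int q * \<theta>" "\<alpha>' = of_int p + of_int q * \<eta>"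
      and rs: "\<beta> = of_int r + of_int s * \<theta>" "\<beta>' = of_int r + of_int s * \<eta>"
    using assms unfolding conjugates_def by blast
  have *: "(of_int p + of_int q * t) * (of_int r + of_int s * t) =
      of_int (p * r + q * s) + of_int (p * s + q * r + int a * q * s) * t"
    if "t\<^sup>2 = of_nat a * t + 1" for t :: real
  proof -
    have "(of_int p + of_int q * t) * (of_int r + of_int s * t) =
        of_int (p * r) + of_int (p * s + q * r) * t + of_int (q * s) * t\<^sup>2"
      by (simp add: algebra_simps power2_eq_square)
    then show ?thesis
      unfolding that by (simp add: algebra_simps)
  qed
  show ?thesis
    unfolding pq rs *[OF theta_square] *[OF eta_square] by (rule conjugatesI)
qed

lemma conjugates_uminus: "conjugates \<alpha> \<alpha>' \<Longrightarrow> conjugates (- \<alpha>) (- \<alpha>')"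
  using conjugates_mult[OF conjugates_of_int[of "-1"]] by simp

lemma conjugates_sum:
  "(\<And>i. i \<in> S \<Longrightarrow> conjugates (f i) (g i)) \<Longrightarrow> conjugates (sum f S) (sum g S)"
  by (induction S rule: infinite_finite_induct)
    (use conjugates_of_int[of 0] in \<open>auto intro: conjugates_add\<close>)

lemma conjugates_prod:
  "(\<And>i. i \<in> S \<Longrightarrow> conjugates (f i) (g i)) \<Longrightarrow> conjugates (prod f S) (prod g S)"
  by (induction S rule: infinite_finite_induct)
    (use conjugates_of_int[of 1] in \<open>auto intro: conjugates_mult\<close>)

lemma conjugates_theta: "conjugates \<theta> \<eta>"
  using conjugatesI[of 0 1] by simp

text \<open>Because \<theta> is a unit, its inverse \<open>\<theta> - a\<close> has integer
  coordinates; this admits negative exponents in greedy polynomials.\<close>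

lemma conjugates_inverse_theta: "conjugates (inverse \<theta>) (inverse \<eta>)"
proof -
  have "inverse \<theta> = of_int (- int a) + of_int 1 * \<theta>"
    using inverse_theta by (simp add: inverse_eq_divide)
  moreover have "inverse \<eta> = of_int (- int a) + of_int 1 * \<eta>"
    using eta_def eta_eq by simp
  ultimately show ?thesis
    using conjugatesI by metis
qed

lemma conjugates_power: "conjugates \<alpha> \<beta> \<Longrightarrow> conjugates (\<alpha> ^ n) (\<beta> ^ n)"
  using conjugates_prod[of "{..<n}" "\<lambda>_. \<alpha>" "\<lambda>_. \<beta>"] by simp

lemma conjugates_theta_powi: "conjugates (\<theta> powi i) (\<eta> powi i)"
  unfolding power_int_def
  by (auto intro: conjugates_power conjugates_theta conjugates_inverse_theta)

lemma conjugates_greedy_value: "conjugates (greedy_value \<theta> b) (greedy_value \<eta> b)"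
  unfolding greedy_value_def
  by (intro conjugates_sum conjugates_mult conjugates_theta_powi)
    (use conjugates_of_int[of "int _"] in simp)

lemma int_adjoin_conjugates:
  assumes "\<alpha> \<in> int_adjoin \<theta>"
  shows "\<exists>\<beta>. conjugates \<alpha> \<beta>"
proof -
  have "\<exists>\<beta>. conjugates (poly (map_poly of_int p) \<theta>) \<beta>" for p :: "int poly"
  proof (induction p)
    case 0
    show ?case
      using conjugates_of_int[of 0] by auto
  next
    case (pCons c p)
    then show ?case
      using conjugates_add[OF conjugates_of_int conjugates_mult[OF conjugates_theta]]
      by (auto simp: map_poly_pCons)
  qed
  then show ?thesis
    using assms unfolding int_adjoin_def by blast
qed

section \<open>Size of the conjugate of a greedy polynomial\<close>

lemma eta_powi: "\<eta> powi n = (if even n then 1 else -1) * \<theta> powi (- n)"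
proof -
  have "\<eta> = - inverse \<theta>"
    by (simp add: eta_def divide_inverse)
  then show ?thesis
    by (simp add: power_int_minus_left power_int_inverse power_int_minus)
qed

lemma eta_power_even: "\<eta> ^ (2 * K) = (1 / \<theta>) ^ (2 * K)"
  unfolding eta_def by (simp add: power_mult power_divide)

text \<open>
  Digits are added two at a time; since \<open>a / \<theta> ^ j = \<theta> / \<theta> ^ j - 1 / \<theta> ^ (j + 1)\<close>, the extreme
  contributions of the pairs telescope.
\<close>

lemma alternating_sum_upper:
  fixes c :: "nat \<Rightarrow> nat"
  assumes "\<And>j. c j \<le> a"
  shows "(\<Sum>j<2 * K. of_nat (c j) * \<eta> ^ j) \<le> \<theta> - \<theta> * (1 / \<theta>) ^ (2 * K)"
proof (induction K)
  case (Suc K)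
  define z where "z = (1 / \<theta>) ^ (2 * K)"
  have z: "z > 0"
    using theta_pos by (simp add: z_def)
  have "(\<Sum>j<2 * Suc K. of_nat (c j) * \<eta> ^ j) =
      (\<Sum>j<2 * K. of_nat (c j) * \<eta> ^ j) + c (2 * K) * z - c (2 * K + 1) * (z / \<theta>)"
    using eta_power_even[of K] by (simp add: z_def eta_def)
  also have "\<dots> \<le> (\<theta> - \<theta> * z) + a * z - 0"
    using Suc.IH assms[of "2 * K"] z theta_pos
    by (intro add_mono diff_mono mult_right_mono) (auto simp: z_def)
  also have "a * z = \<theta> * z - z / \<theta>"
    using inverse_theta
    by (metis diff_diff_eq2 add_diff_cancel_left' left_diff_distrib times_divide_eq_left mult_1)
  also have "(\<theta> - \<theta> * z) + (\<theta> * z - z / \<theta>) - 0 = \<theta> - \<theta> * (1 / \<theta>) ^ (2 * Suc K)"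
    using theta_pos by (simp add: z_def power2_eq_square)
  finally show ?case .
qed simp

text \<open>Unlike the upper bound, this one needs conditions on the lowest pair of digits: its
  worst case is \<open>c 0 = 1\<close>, \<open>c 1 = a - 1\<close>, with value
  \<open>1 / \<theta> + (1 / \<theta>)\<^sup>2\<close>. Every later pair loses at most
  \<open>a\<close> times an odd power of \<open>1 / \<theta>\<close>, and these losses telescope as
  before.\<close>

lemma alternating_sum_lower:
  fixes c :: "nat \<Rightarrow> nat"
  assumes "\<And>j. c j \<le> a" and "c 0 \<noteq> 0" and "c 1 \<noteq> a"
  shows "(\<Sum>j<2 * Suc K. of_nat (c j) * \<eta> ^ j) \<ge> 1 / \<theta> + (1 / \<theta>) ^ (2 * Suc K)"
proof (induction K)
  case 0
  have "c 1 + 1 \<le> a"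
    using assms(1)[of 1] assms(3) by simp
  then have "real (c 1) \<le> real a - 1"
    by linarith
  then have "c 1 / \<theta> \<le> (real a - 1) / \<theta>"
    using theta_pos by (intro divide_right_mono) auto
  also have "(real a - 1) / \<theta> = 1 - 1 / \<theta> - (1 / \<theta>)\<^sup>2"
  proof -
    have "real a = \<theta> - 1 / \<theta>"
      using inverse_theta by simp
    then have "(real a - 1) / \<theta> = (\<theta> - 1 / \<theta> - 1) / \<theta>"
      by simp
    then show ?thesis
      using theta_pos by (simp add: diff_divide_distrib power2_eq_square)
  qed
  finally have "c 1 / \<theta> \<le> 1 - 1 / \<theta> - (1 / \<theta>)\<^sup>2" .
  moreover have "(\<Sum>j<2 * Suc 0. of_nat (c j) * \<eta> ^ j) = c 0 - c 1 / \<theta>"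
    by (simp add: eta_def numeral_2_eq_2)
  moreover have "real (c 0) \<ge> 1"
    using assms(2) by simp
  ultimately show ?case
    by simp
next
  case (Suc K)
  define z where "z = (1 / \<theta>) ^ (2 * Suc K)"
  have z: "z > 0"
    using theta_pos by (simp add: z_def)
  have az: "a * (z / \<theta>) = z - z / \<theta>\<^sup>2"
  proof -
    have "real a = \<theta> - 1 / \<theta>"
      using inverse_theta by simp
    then have "a * (z / \<theta>) = (\<theta> - 1 / \<theta>) * (z / \<theta>)"
      by simp
    then show ?thesis
      using theta_pos by (simp add: left_diff_distrib diff_divide_distrib power2_eq_square)
  qed
  have "1 / \<theta> + (1 / \<theta>) ^ (2 * Suc (Suc K)) = (1 / \<theta> + z) + 0 - a * (z / \<theta>)"
    unfolding az using theta_pos by (simp add: z_def power2_eq_square)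
  also have "\<dots> \<le> (\<Sum>j<2 * Suc K. of_nat (c j) * \<eta> ^ j) + c (2 * Suc K) * z
      - c (2 * Suc K + 1) * (z / \<theta>)"
    using Suc.IH assms(1)[of "2 * Suc K + 1"] z theta_pos
    by (intro add_mono diff_mono mult_right_mono) (auto simp: z_def)
  also have "\<dots> = (\<Sum>j<2 * Suc (Suc K). of_nat (c j) * \<eta> ^ j)"
  proof -
    have "2 * Suc (Suc K) = Suc (Suc (2 * Suc K))"
      by simp
    then show ?thesis
      using eta_power_even[of "Suc K"] unfolding z_def
      by (simp only: sum.lessThan_Suc power_Suc2) (simp add: eta_def)
  qed
  finally show ?case .
qed

lemma greedy_value_conjugate_bounds:
  assumes "greedy_digits a b" and "b m \<noteq> 0" and "\<And>i. i < m \<Longrightarrow> b i = 0"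
  obtains u where "greedy_value \<eta> b = \<eta> powi m * u" and "1 / \<theta> < u" and "u < \<theta>"
proof -
  have fin: "finite {i. b i \<noteq> 0}" and le: "\<And>i. b i \<le> a"
    and adm: "\<And>i. b i = a \<Longrightarrow> b (i - 1) = 0"
    using assms(1) unfolding greedy_digits_def by auto
  define M where "M = Max {i. b i \<noteq> 0}"
  have M: "i \<le> M" if "b i \<noteq> 0" for i
    using that fin by (auto simp: M_def)
  define K where "K = nat (M - m)"
  define c where "c j = b (m + int j)" for j
  \<comment> \<open>The number of terms is even to fit the pairwise bounds, and larger than
    \<open>M - m\<close>, so the whole support is covered; the excess digits are zero.\<close>
  define L where "L = 2 * Suc K"
  define u where "u = (\<Sum>j<L. of_nat (c j) * \<eta> ^ j)"
  have "greedy_value \<eta> b = (\<Sum>i\<in>(\<lambda>j. m + int j) ` {..<L}. of_nat (b i) * \<eta> powi i)"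
  proof (rule greedy_value_eq_sum)
    fix i
    assume i: "b i \<noteq> 0"
    then have "m \<le> i" "i \<le> M"
      using assms(3)[of i] M by (auto simp: not_less[symmetric])
    then have "i = m + int (nat (i - m))" "nat (i - m) < L"
      by (auto simp: K_def L_def)
    then show "i \<in> (\<lambda>j. m + int j) ` {..<L}"
      by blast
  qed auto
  also have "\<dots> = \<eta> powi m * u"
    using eta_nonzero
    by (subst sum.reindex)
      (auto simp: u_def c_def sum_distrib_left power_int_add mult_ac inj_on_def)
  finally have "greedy_value \<eta> b = \<eta> powi m * u" .
  \<comment> \<open>If \<open>c 1\<close> were \<open>a\<close>, admissibility at
    \<open>m + 1\<close> would force \<open>b m = 0\<close>. The positive extra terms in this and
    the next bound give the strict inequalities.\<close>
  moreover have "1 / \<theta> + (1 / \<theta>) ^ (2 * Suc K) \<le> u"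
    unfolding u_def L_def
    by (rule alternating_sum_lower) (use le assms(2) adm[of "m + 1"] in \<open>auto simp: c_def\<close>)
  moreover have "u \<le> \<theta> - \<theta> * (1 / \<theta>) ^ (2 * Suc K)"
    unfolding u_def L_def by (rule alternating_sum_upper) (use le in \<open>auto simp: c_def\<close>)
  moreover have "(1 / \<theta>) ^ (2 * Suc K) > 0" "\<theta> * (1 / \<theta>) ^ (2 * Suc K) > 0"
    using theta_pos by auto
  ultimately show ?thesis
    using that[of u] by linarith
qed

section \<open>Uniqueness of the lowest exponent\<close>

lemma theta_powi_less_iff: "\<theta> powi m < \<theta> powi n \<longleftrightarrow> m < n"
  using power_int_strict_increasing[of m n \<theta>] power_int_increasing[of n m \<theta>] theta_gt_1
  by (metis less_imp_le linorder_not_less)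

text \<open>
  The sign of the conjugate fixes the parity of \<open>m\<close>, and its size leaves an open interval of
  length two for \<open>m\<close>.
\<close>

lemma greedy_expansion_unique:
  assumes "greedy_expansion a \<theta> \<alpha> m b" and "greedy_expansion a \<theta> \<alpha> n c"
  shows "m = n"
proof -
  have b: "greedy_digits a b" "b m \<noteq> 0" "\<And>i. i < m \<Longrightarrow> b i = 0"
    and c: "greedy_digits a c" "c n \<noteq> 0" "\<And>i. i < n \<Longrightarrow> c i = 0"
    and vals: "\<alpha> = greedy_value \<theta> b \<or> \<alpha> = - greedy_value \<theta> b"
      "\<alpha> = greedy_value \<theta> c \<or> \<alpha> = - greedy_value \<theta> c"
    using assms unfolding greedy_expansion_def by auto
  \<comment> \<open>Greedy values are positive, so the two sign choices for \<alpha> must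
    agree.\<close>
  have "greedy_value \<theta> b = greedy_value \<theta> c"
    using vals greedy_value_pos[OF b(1) theta_pos b(2)] greedy_value_pos[OF c(1) theta_pos c(2)]
    by linarith
  then have eq: "greedy_value \<eta> b = greedy_value \<eta> c"
    using conjugates_unique conjugates_greedy_value by metis
  obtain u where u: "greedy_value \<eta> b = \<eta> powi m * u" "1 / \<theta> < u" "u < \<theta>"
    using greedy_value_conjugate_bounds[OF b] .
  obtain v where v: "greedy_value \<eta> c = \<eta> powi n * v" "1 / \<theta> < v" "v < \<theta>"
    using greedy_value_conjugate_bounds[OF c] .
  have pos: "u > 0" "v > 0"
    using u v theta_pos by (meson less_trans zero_less_divide_1_iff)+
  have "\<eta> powi (m - n) = v / u"
    using u(1) v(1) eq pos eta_nonzero by (simp add: power_int_diff field_simps)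
  then have quot: "(if even (m - n) then 1 else -1) * \<theta> powi (n - m) = v / u"
    unfolding eta_powi by simp
  have "\<theta> powi (n - m) > 0" "v / u > 0"
    using theta_pos pos by auto
  then have even: "even (m - n)"
    using quot by (metis mult_minus1 neg_less_0_iff_less not_less_iff_gr_or_eq)
  then have quot: "\<theta> powi (n - m) = v / u"
    using quot by simp
  have "v / u < \<theta> / (1 / \<theta>)"
    using u v pos theta_pos by (intro frac_less) auto
  then have "\<theta> powi (n - m) < \<theta> powi 2"
    using quot by (simp add: power2_eq_square)
  moreover have "(1 / \<theta>) / \<theta> < v / u"
    using u v pos theta_pos by (intro frac_less) auto
  then have "\<theta> powi (-2) < \<theta> powi (n - m)"
    using quot by (simp add: power2_eq_square power_int_minus field_simps)
  ultimately have "n - m < 2" "-2 < n - m"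
    unfolding theta_powi_less_iff by auto
  then show ?thesis
    using even by presburger
qed

section \<open>Existence of greedy expansions\<close>

text \<open>
  Here \<open>x\<close> is a remainder of the greedy algorithm and \<open>y\<close> its conjugate. One step,
  \<open>x \<mapsto> \<theta> x - d\<close>, contracts the conjugate towards \<open>{-\<theta>..1}\<close>; in the
  \<open>1 / \<theta>\<close>-neighbourhood of that interval the only remainders are \<open>0\<close> and \<open>1 / \<theta>\<close>.
\<close>

lemma small_remainder:
  assumes "conjugates x y" and "0 \<le> x" "x < 1"
    and "- \<theta> - 1 / \<theta> \<le> y" "y \<le> 1 + 1 / \<theta>"
  shows "x = 0 \<or> x = 1 / \<theta>"
proof -
  obtain p q :: int where x: "x = of_int p + of_int q * \<theta>" and y: "y = of_int p + of_int q * \<eta>"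
    using assms(1) unfolding conjugates_def by blast
  \<comment> \<open>\<open>D\<close> is the difference of \<theta> and \<eta>, so
    \<open>x - y\<close> determines \<open>q\<close>. The hypotheses put \<open>x - y\<close>
    strictly between \<open>- D\<close> and \<open>2 * D\<close>, which leaves only
    \<open>q = 0\<close> and \<open>q = 1\<close>.\<close>
  define D where "D = \<theta> + 1 / \<theta>"
  have xy: "x - y = of_int q * D"
    unfolding x y D_def eta_def by (simp add: algebra_simps)
  have D: "D > 1 + 1 / \<theta>" "D > \<theta>"
    using theta_gt_1 by (auto simp: D_def)
  have "of_int q * D > (-1) * D"
    using xy assms D by simp
  then have "q > -1"
    using D theta_gt_1 by (subst (asm) mult_less_cancel_right) auto
  have "of_int q * D < 2 * D"
    using xy assms D by linarith
  then have "q < 2"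
    using D theta_gt_1 by (subst (asm) mult_less_cancel_right) auto
  then consider "q = 0" | "q = 1"
    using \<open>q > -1\<close> by linarith
  then show ?thesis
  proof cases
    case 1
    then have "0 \<le> p" "p < 1"
      using x assms by auto
    then show ?thesis
      using x 1 by simp
  next
    case 2
    then have "0 \<le> of_int p + \<theta>" "of_int p + \<theta> < 1"
      using x assms by auto
    then have "p = - int a"
      using theta_bounds by linarith
    then show ?thesis
      using x 2 inverse_theta by simp
  qed
qed

lemma greedy_digits_zero: "greedy_digits a (\<lambda>_. 0)"
  unfolding greedy_digits_def by auto

text \<open>Undoes one step of the greedy algorithm: the digit \<open>d\<close> is put at position 0
  above the expansion \<open>c\<close> of the remainder, and everything is shifted down by one,
  which divides by \<theta>.\<close>

lemma greedy_digits_extend: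
  assumes c: "greedy_digits a c" "\<And>i. i \<ge> 0 \<Longrightarrow> c i = 0"
    and v: "greedy_value \<theta> c = \<theta> * x - of_nat d" "x < 1" and d: "d \<le> a"
  shows "\<exists>b. greedy_digits a b \<and> (\<forall>i\<ge>0. b i = 0) \<and> greedy_value \<theta> b = x"
proof -
  have c0: "c 0 = 0"
    using c by simp
  define e where "e = c(0 := d)"
  have "{i. e i \<noteq> 0} \<subseteq> insert 0 {i. c i \<noteq> 0}"
    by (auto simp: e_def)
  then have fin: "finite {i. e i \<noteq> 0}"
    using c(1) unfolding greedy_digits_def by (meson finite_insert finite_subset)
  \<comment> \<open>If the new digit is \<open>a\<close>, then \<open>x < 1\<close> makes the
    remainder smaller than \<open>\<theta> - a = 1 / \<theta>\<close>, too small for a nonzero digit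
    at position -1.\<close>
  have next0: "c (-1) = 0" if "d = a"
  proof -
    have "real (c (-1)) / \<theta> \<le> greedy_value \<theta> c"
      using digit_le_greedy_value[OF c(1) theta_pos, of "-1"]
      by (simp add: power_int_minus divide_inverse)
    also have "\<dots> < \<theta> * 1 - a"
      using v that theta_pos by simp
    also have "\<dots> = 1 / \<theta>"
      using inverse_theta by simp
    finally show ?thesis
      using theta_pos by (simp add: divide_less_cancel)
  qed
  have "greedy_digits a e"
    unfolding greedy_digits_def
  proof (intro conjI allI impI)
    show "e i \<le> a" for i
      using c(1) d by (auto simp: e_def greedy_digits_def)
    fix i
    assume i: "e i = a"
    show "e (i - 1) = 0"
    proof (cases "i = 0")
      case True
      then show ?thesis
        using i next0 by (simp add: e_def)
    next
      case False
      then have "c i = a"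
        using i by (simp add: e_def)
      then have "c (i - 1) = 0" "i < 0"
        using c(1) c(2)[of i] a_ge_1 unfolding greedy_digits_def by (auto simp: not_less[symmetric])
      then show ?thesis
        by (simp add: e_def)
    qed
  qed (fact fin)
  then have "greedy_digits a (\<lambda>i. e (i - (-1)))"
    by (rule greedy_digits_shift)
  moreover have "\<forall>i\<ge>0. e (i - (-1)) = 0"
    using c by (auto simp: e_def)
  moreover have "greedy_value \<theta> (\<lambda>i. e (i - (-1))) = x"
    using theta_pos v greedy_value_fun_upd[OF c(1) c0, of \<theta> d]
    by (subst greedy_value_shift) (auto simp: e_def power_int_minus field_simps)
  ultimately show ?thesis
    by blast
qed

text \<open>Termination of the greedy algorithm. The margin \<open>\<theta> ^ n / \<theta>\<close>
  around the interval from \<open>- \<theta>\<close> to 1 shrinks by a factor \<theta> in each step,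
  so \<open>n\<close> bounds the number of steps until the margin is \<open>1 / \<theta>\<close> and
  \<open>small_remainder\<close> applies.\<close>

lemma fractional_greedy_expansion:
  assumes "conjugates x y" and "0 \<le> x" "x < 1"
    and "- \<theta> - \<theta> ^ n / \<theta> \<le> y" "y \<le> 1 + \<theta> ^ n / \<theta>"
  shows "\<exists>b. greedy_digits a b \<and> (\<forall>i\<ge>0. b i = 0) \<and> greedy_value \<theta> b = x"
  using assms
proof (induction n arbitrary: x y)
  case 0
  then consider "x = 0" | "x = 1 / \<theta>"
    using small_remainder[of x y] by auto
  then show ?case
  proof cases
    case 1
    then show ?thesis
      using greedy_digits_zero by (intro exI[of _ "\<lambda>_. 0"]) (auto simp: greedy_value_def)
  next
    \<comment> \<open>The expansion is the single digit 1 at position -1: one greedy step with digit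
      1 leaves remainder 0.\<close>
    case 2
    then show ?thesis
      using greedy_digits_zero theta_pos a_ge_1 0
      by (intro greedy_digits_extend[of "\<lambda>_. 0" x 1]) (auto simp: greedy_value_def)
  qed
next
  case (Suc n)
  define d where "d = nat \<lfloor>\<theta> * x\<rfloor>"
  have "0 \<le> \<theta> * x"
    using Suc.prems theta_pos by simp
  then have d: "real d \<le> \<theta> * x" "\<theta> * x < real d + 1"
    unfolding d_def by linarith+
  have "\<theta> * x < \<theta> * 1"
    using Suc.prems theta_pos by (intro mult_strict_left_mono) auto
  then have "real d < real a + 1"
    using d theta_bounds by linarith
  then have "d \<le> a"
    by linarith
  have conj: "conjugates (\<theta> * x - d) (\<eta> * y - d)"
    using conjugates_add[OF conjugates_mult[OF conjugates_theta Suc.prems(1)]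
        conjugates_of_int[of "- int d"]] by simp
  have eta_y: "\<eta> * y = - (y / \<theta>)"
    by (simp add: eta_def)
  have "y / \<theta> \<le> (1 + \<theta> ^ Suc n / \<theta>) / \<theta>"
    using Suc.prems theta_pos by (intro divide_right_mono) auto
  also have "\<dots> = 1 / \<theta> + \<theta> ^ n / \<theta>"
    using theta_pos by (simp add: add_divide_distrib)
  finally have upper: "y / \<theta> \<le> 1 / \<theta> + \<theta> ^ n / \<theta>" .
  have "(- \<theta> - \<theta> ^ Suc n / \<theta>) / \<theta> \<le> y / \<theta>"
    using Suc.prems theta_pos by (intro divide_right_mono) auto
  also have "(- \<theta> - \<theta> ^ Suc n / \<theta>) / \<theta> = - 1 - \<theta> ^ n / \<theta>"
    using theta_pos by (simp add: diff_divide_distrib)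
  finally have lower: "- 1 - \<theta> ^ n / \<theta> \<le> y / \<theta>" .
  have "\<exists>b. greedy_digits a b \<and> (\<forall>i\<ge>0. b i = 0) \<and> greedy_value \<theta> b = \<theta> * x - d"
    using conj
  proof (rule Suc.IH)
    \<comment> \<open>Multiplication by the negative number \<eta> swaps the bounds. The worst digit
      is \<open>d = a\<close>, and \<open>1 / \<theta> + a = \<theta>\<close> reproduces the left
      endpoint of the interval.\<close>
    show "- \<theta> - \<theta> ^ n / \<theta> \<le> \<eta> * y - d"
      using eta_y upper inverse_theta \<open>d \<le> a\<close> by simp
    show "\<eta> * y - d \<le> 1 + \<theta> ^ n / \<theta>"
      using eta_y lower by simp
  qed (use d in auto)
  then show ?case
    using greedy_digits_extend Suc.prems(3) \<open>d \<le> a\<close> by blast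
qed

text \<open>Dividing the absolute value of \<alpha> by a large power of \<theta> moves it below 1,
  where the fractional case applies; shifting the digits back and taking the least position of the
  support gives \<open>m\<close>.\<close>

lemma greedy_expansion_exists:
  assumes "conjugates \<alpha> \<beta>" and "\<alpha> \<noteq> 0"
  shows "\<exists>m b. greedy_expansion a \<theta> \<alpha> m b"
proof -
  have "\<exists>\<gamma>. conjugates \<bar>\<alpha>\<bar> \<gamma>"
    using assms conjugates_uminus[of \<alpha> \<beta>] by (auto simp: abs_if)
  then obtain \<gamma> where \<gamma>: "conjugates \<bar>\<alpha>\<bar> \<gamma>" ..
  obtain N where N: "\<bar>\<alpha>\<bar> < \<theta> ^ N"
    using real_arch_pow theta_gt_1 by blast
  define x where "x = \<theta> powi (- int N) * \<bar>\<alpha>\<bar>"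
  define y where "y = \<eta> powi (- int N) * \<gamma>"
  have conj: "conjugates x y"
    unfolding x_def y_def by (intro conjugates_mult conjugates_theta_powi \<gamma>)
  have x: "0 \<le> x" "x < 1" and \<alpha>: "\<bar>\<alpha>\<bar> = \<theta> powi int N * x"
    using N theta_pos by (auto simp: x_def power_int_minus field_simps)
  \<comment> \<open>Any \<open>n\<close> whose margin \<open>\<theta> ^ n / \<theta>\<close> exceeds
    the absolute value of \<open>y\<close> will do.\<close>
  obtain n where "\<theta> * \<bar>y\<bar> < \<theta> ^ n"
    using real_arch_pow theta_gt_1 by blast
  then have "\<bar>y\<bar> < \<theta> ^ n / \<theta>"
    using theta_pos by (simp add: field_simps)
  then obtain b where b: "greedy_digits a b" "greedy_value \<theta> b = x"
    using fractional_greedy_expansion[OF conj x, of n] theta_pos by (auto simp: abs_less_iff)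
  define c where "c i = b (i - int N)" for i
  define S where "S = {i. c i \<noteq> 0}"
  have c: "greedy_digits a c" "greedy_value \<theta> c = \<bar>\<alpha>\<bar>"
    unfolding c_def
    using greedy_digits_shift[OF b(1)] greedy_value_shift[of \<theta> b "int N"] b theta_pos \<alpha>
    by auto
  have fin: "finite S"
    using c(1) by (simp add: greedy_digits_def S_def)
  moreover have "S \<noteq> {}"
  proof
    assume "S = {}"
    then have "greedy_value \<theta> c = 0"
      unfolding greedy_value_def S_def[symmetric] by (simp only: sum.empty)
    then show False
      using c assms(2) by simp
  qed
  ultimately have "Min S \<in> S"
    by (rule Min_in)
  then have "c (Min S) \<noteq> 0"
    by (simp add: S_def)
  moreover have "c i = 0" if "i < Min S" for i
  proof (rule ccontr)
    assume "c i \<noteq> 0"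
    then have "Min S \<le> i"
      using fin by (intro Min_le) (simp_all add: S_def)
    then show False
      using that by simp
  qed
  moreover have "\<alpha> = greedy_value \<theta> c \<or> \<alpha> = - greedy_value \<theta> c"
    unfolding c(2) by linarith
  ultimately have "greedy_expansion a \<theta> \<alpha> (Min S) c"
    using c(1) unfolding greedy_expansion_def by blast
  then show ?thesis
    by blast
qed

section \<open>Comparison of the infranorm with the conjugate, and products\<close>

text \<open>The absolute value of \<beta> is the infranorm of \<alpha> times the factor
  \<open>u\<close> of \<open>greedy_value_conjugate_bounds\<close>. The exponent obtained is the
  negative of the lowest digit position.\<close>

lemma infranorm_conjugate:
  assumes "conjugates \<alpha> \<beta>" and "\<alpha> \<noteq> 0"
  obtains m where "infranorm a \<theta> \<alpha> = \<theta> powi m"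
    and "\<theta> powi (m - 1) < \<bar>\<beta>\<bar>" and "\<bar>\<beta>\<bar> < \<theta> powi (m + 1)"
proof -
  obtain m b where exp: "greedy_expansion a \<theta> \<alpha> m b"
    using greedy_expansion_exists[OF assms] by blast
  then have "(THE m. \<exists>b. greedy_expansion a \<theta> \<alpha> m b) = m"
    using greedy_expansion_unique by blast
  then have norm: "infranorm a \<theta> \<alpha> = \<theta> powi (- m)"
    using assms(2) by (simp add: infranorm_def)
  have b: "greedy_digits a b" "b m \<noteq> 0" "\<And>i. i < m \<Longrightarrow> b i = 0"
    and val: "\<alpha> = greedy_value \<theta> b \<or> \<alpha> = - greedy_value \<theta> b"
    using exp unfolding greedy_expansion_def by auto
  obtain u where u: "greedy_value \<eta> b = \<eta> powi m * u" "1 / \<theta> < u" "u < \<theta>"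
    using greedy_value_conjugate_bounds[OF b] .
  have "u > 0"
    using u theta_pos by (meson less_trans zero_less_divide_1_iff)
  have "\<bar>\<beta>\<bar> = \<bar>greedy_value \<eta> b\<bar>"
    using val conjugates_unique[OF assms(1)] conjugates_greedy_value conjugates_uminus
    by (metis abs_minus_cancel)
  also have "\<dots> = \<theta> powi (- m) * u"
    unfolding u(1) eta_powi using \<open>u > 0\<close> theta_pos by (simp add: abs_mult)
  finally have \<beta>: "\<bar>\<beta>\<bar> = \<theta> powi (- m) * u" .
  have pos: "\<theta> powi (- m) > 0"
    using theta_pos by simp
  have "\<theta> powi (- m - 1) < \<bar>\<beta>\<bar>"
    using mult_strict_left_mono[OF u(2) pos] theta_pos by (simp add: \<beta> power_int_diff)
  moreover have "\<bar>\<beta>\<bar> < \<theta> powi (- m + 1)"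
    using mult_strict_left_mono[OF u(3) pos] power_int_add_1[of \<theta> "- m"] theta_pos
    unfolding \<beta> by simp
  ultimately show ?thesis
    using norm that by blast
qed

lemma theta_powi_sum: "(\<Prod>i\<in>S. \<theta> powi f i) = \<theta> powi (\<Sum>i\<in>S. f i)"
  by (induction S rule: infinite_finite_induct) (use theta_pos in \<open>auto simp: power_int_add\<close>)

lemma infranorm_prod_bounds:
  assumes "\<And>i. i \<in> {1..k} \<Longrightarrow> x i \<in> int_adjoin \<theta>"
  shows "\<theta> powi (- int k) * (\<Prod>i=1..k. infranorm a \<theta> (x i)) \<le> infranorm a \<theta> (\<Prod>i=1..k. x i)"
    and "infranorm a \<theta> (\<Prod>i=1..k. x i) \<le> \<theta> powi int k * (\<Prod>i=1..k. infranorm a \<theta> (x i))"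
proof -
  have "\<theta> powi (- int k) * (\<Prod>i=1..k. infranorm a \<theta> (x i)) \<le> infranorm a \<theta> (\<Prod>i=1..k. x i) \<and>
      infranorm a \<theta> (\<Prod>i=1..k. x i) \<le> \<theta> powi int k * (\<Prod>i=1..k. infranorm a \<theta> (x i))"
  \<comment> \<open>Zero has no greedy expansion, so the comparison with conjugates needs nonzero
    factors; a zero factor makes all terms vanish.\<close>
  proof (cases "\<exists>i\<in>{1..k}. x i = 0")
    case True
    then have "(\<Prod>i=1..k. x i) = 0" "(\<Prod>i=1..k. infranorm a \<theta> (x i)) = 0"
      by (auto simp: infranorm_def)
    then show ?thesis
      by (simp only: infranorm_def) simp
  next
    case False
    obtain y where y: "\<And>i. i \<in> {1..k} \<Longrightarrow> conjugates (x i) (y i)"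
      using int_adjoin_conjugates[OF assms] by metis
    have "\<exists>m. infranorm a \<theta> (x i) = \<theta> powi m \<and>
        \<theta> powi (m - 1) < \<bar>y i\<bar> \<and> \<bar>y i\<bar> < \<theta> powi (m + 1)" if "i \<in> {1..k}" for i
    proof -
      have "x i \<noteq> 0"
        using False that by blast
      with y[OF that] show ?thesis
        by (rule infranorm_conjugate) blast
    qed
    then have "\<forall>i\<in>{1..k}. \<exists>m. infranorm a \<theta> (x i) = \<theta> powi m \<and>
        \<theta> powi (m - 1) < \<bar>y i\<bar> \<and> \<bar>y i\<bar> < \<theta> powi (m + 1)"
      by blast
    from bchoice[OF this] obtain m
      where m: "\<And>i. i \<in> {1..k} \<Longrightarrow> infranorm a \<theta> (x i) = \<theta> powi m i"
        "\<And>i. i \<in> {1..k} \<Longrightarrow> \<theta> powi (m i - 1) < \<bar>y i\<bar>"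
        "\<And>i. i \<in> {1..k} \<Longrightarrow> \<bar>y i\<bar> < \<theta> powi (m i + 1)"
      by blast
    have "(\<Prod>i=1..k. x i) \<noteq> 0"
      using False by auto
    with conjugates_prod[OF y] obtain M
      where M: "infranorm a \<theta> (\<Prod>i=1..k. x i) = \<theta> powi M"
        "\<theta> powi (M - 1) < \<bar>\<Prod>i=1..k. y i\<bar>" "\<bar>\<Prod>i=1..k. y i\<bar> < \<theta> powi (M + 1)"
      by (rule infranorm_conjugate)
    define s where "s = (\<Sum>i=1..k. m i)"
    have norms: "(\<Prod>i=1..k. infranorm a \<theta> (x i)) = \<theta> powi s"
      unfolding s_def theta_powi_sum[symmetric] by (rule prod.cong) (use m(1) in auto)
    have "\<theta> powi (s - int k) = (\<Prod>i=1..k. \<theta> powi (m i - 1))"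
      by (simp add: theta_powi_sum s_def sum_subtractf)
    also have "\<dots> \<le> \<bar>\<Prod>i=1..k. y i\<bar>"
      unfolding abs_prod
      by (rule prod_mono) (use m(2) theta_pos in \<open>auto intro: less_imp_le\<close>)
    also have "\<dots> < \<theta> powi (M + 1)"
      by (rule M(3))
    \<comment> \<open>The strict bound for the product gives \<open>s - int k < M + 1\<close>;
      integrality of the exponents turns this into the claimed inequality. The upper bound is
      symmetric.\<close>
    finally have lower: "s - int k \<le> M"
      unfolding theta_powi_less_iff by simp
    have "\<theta> powi (M - 1) < \<bar>\<Prod>i=1..k. y i\<bar>"
      by (rule M(2))
    also have "\<dots> \<le> (\<Prod>i=1..k. \<theta> powi (m i + 1))"
      unfolding abs_prod
      by (rule prod_mono) (use m(3) in \<open>auto intro: less_imp_le\<close>)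
    also have "\<dots> = \<theta> powi (s + int k)"
      by (simp add: theta_powi_sum s_def sum.distrib)
    finally have upper: "M \<le> s + int k"
      unfolding theta_powi_less_iff by simp
    have "\<theta> powi (- int k + s) \<le> \<theta> powi M" "\<theta> powi M \<le> \<theta> powi (int k + s)"
      using lower upper theta_gt_1 by (auto intro!: power_int_increasing)
    then show ?thesis
      unfolding norms M(1) using theta_pos by (subst (asm) (1 2) power_int_add) auto
  qed
  then show "\<theta> powi (- int k) * (\<Prod>i=1..k. infranorm a \<theta> (x i)) \<le> infranorm a \<theta> (\<Prod>i=1..k. x i)"
    and "infranorm a \<theta> (\<Prod>i=1..k. x i) \<le> \<theta> powi int k * (\<Prod>i=1..k. infranorm a \<theta> (x i))"
    by blast+
qed

end

theorem theorem5:
  fixes \<theta> :: real and a k :: nat and x :: "nat \<Rightarrow> real"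
  assumes "\<theta> > 1" and "a \<ge> 1" and "\<theta>\<^sup>2 = of_nat a * \<theta> + 1"
    and "k \<ge> 2"
    and "\<And>i. i \<in> {1..k} \<Longrightarrow> x i \<in> ring_of_ints \<theta>"
    and "\<And>i. i \<in> {1..k} \<Longrightarrow> x i \<in> int_adjoin \<theta>"
  shows "\<theta> powi (- int k) * (\<Prod>i=1..k. infranorm a \<theta> (x i)) \<le> infranorm a \<theta> (\<Prod>i=1..k. x i)
       \<and> infranorm a \<theta> (\<Prod>i=1..k. x i) \<le> \<theta> ^ k * (\<Prod>i=1..k. infranorm a \<theta> (x i))"
proof -
  interpret quadratic_unit \<theta> "- 1 / \<theta>" a
    by unfold_locales (use assms in auto)
  show ?thesis
    using infranorm_prod_bounds[OF assms(6)] by simp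
qed

end
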